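(* Let $d_\star=2-\sqrt3$. For every $\gamma,\rho>0$, there exists $n_0\in\mathbb{N}$ such that, for every $n\ge n_0$, there is an $n$-vertex $(\rho,d_\star)$-dense $3$-graph $H$ with $\delta_2(H)\ge (d_\star-\gamma)n$ which contains no tight Hamiltonian cycle.
   Context: A $3$-graph $H$ is a $3$-uniform hypergraph with vertex set $V(H)$ and edge set $E(H)\subseteq\binom{V(H)}{3}$. For $X_1,X_2,X_3\subseteq V(H)$ (not necessarily disjoint), $e_H(X_1,X_2,X_3)$ is the number of ordered triples $(x_1,x_2,x_3)\in X_1\times X_2\times X_3$ with distinct entries and $x_1x_2x_3\in E(H)$. An $n$-vertex $3$-graph $H$ is $(\rho,d)$-dense if for all $X_1,X_2,X_3\subseteq V(H)$ one has $e_H(X_1,X_2,X_3)\ge d|X_1||X_2||X_3|-\rho n^3$. The minimum codegree $\delta_2(H)$ is the minimum, over all pairs of distinct vertices $u,v$, of the number of edges of $H$ containing both $u$ and $v$. A tight cycle of length $m\ge4$ is a cyclic ordering of distinct vertices $v_1,\dots,v_m$ with $v_iv_{i+1}v_{i+2}\in E(H)$ for all $i\in\mathbb Z/m\mathbb Z$; it is a tight Hamiltonian cycle if it contains all vertices of $H$. *)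

theory Defs
  imports Complex_Main
begin

definition three_graph :: "'a set \<Rightarrow> 'a set set \<Rightarrow> bool" where
  "three_graph V E \<longleftrightarrow> finite V \<and> E \<subseteq> {e. e \<subseteq> V \<and> card e = 3}"

definition edge_count :: "'a set set \<Rightarrow> 'a set \<Rightarrow> 'a set \<Rightarrow> 'a set \<Rightarrow> nat" where
  "edge_count E X1 X2 X3 =
     card {(x1, x2, x3) \<in> X1 \<times> X2 \<times> X3.
             x1 \<noteq> x2 \<and> x1 \<noteq> x3 \<and> x2 \<noteq> x3 \<and> {x1, x2, x3} \<in> E}"

definition dense_three_graph :: "real \<Rightarrow> real \<Rightarrow> 'a set \<Rightarrow> 'a set set \<Rightarrow> bool" where
  "dense_three_graph \<rho> d V E \<longleftrightarrow>
     (\<forall>X1 X2 X3. X1 \<subseteq> V \<longrightarrow> X2 \<subseteq> V \<longrightarrow> X3 \<subseteq> V \<longrightarrow>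
        real (edge_count E X1 X2 X3)
          \<ge> d * real (card X1) * real (card X2) * real (card X3) - \<rho> * real (card V) ^ 3)"

definition codegree :: "'a set set \<Rightarrow> 'a \<Rightarrow> 'a \<Rightarrow> nat" where
  "codegree E u v = card {e \<in> E. u \<in> e \<and> v \<in> e}"

(* Meaningful only if V is finite with at least two vertices; otherwise Min is applied
   to an empty or infinite set and its value is unspecified. *)
definition min_codegree :: "'a set \<Rightarrow> 'a set set \<Rightarrow> nat" where
  "min_codegree V E = Min {codegree E u v | u v. u \<in> V \<and> v \<in> V \<and> u \<noteq> v}"

(* The cyclic ordering is represented by a list; indices are taken modulo its length. *)
definition tight_cycle :: "'a set \<Rightarrow> 'a set set \<Rightarrow> 'a list \<Rightarrow> bool" where
  "tight_cycle V E vs \<longleftrightarrow>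
     length vs \<ge> 4 \<and> distinct vs \<and> set vs \<subseteq> V \<and>
     (\<forall>i < length vs.
        {vs ! i, vs ! ((i + 1) mod length vs), vs ! ((i + 2) mod length vs)} \<in> E)"

definition tight_Hamiltonian_cycle :: "'a set \<Rightarrow> 'a set set \<Rightarrow> 'a list \<Rightarrow> bool" where
  "tight_Hamiltonian_cycle V E vs \<longleftrightarrow> tight_cycle V E vs \<and> set vs = V"

definition d_star :: real where
  "d_star = 2 - sqrt 3"

end

theory Submission
  imports Defs "HOL-Number_Theory.Cong" "HOL-Analysis.Convex"
begin

text \<open>
  Split the vertices into \<open>A\<close>, a little smaller than a third, and \<open>B\<close>. Colour the pairs inside \<open>B\<close> blue
  quasirandomly with density \<open>u\<close> and all other pairs red, and take as edges the blue triples and the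
  red triples meeting \<open>A\<close>. A tight cycle cannot change colour; a blue one misses \<open>A\<close>, and a red one
  has at most \<open>3 |A| < n\<close> vertices. A red pair has codegree about \<open>|A|\<close>, a blue one at least
  \<open>(2 u - 1) |B|\<close>, and the density is at least \<open>min (1 - u) (u\<^sup>3)\<close>. With \<open>u\<close> near \<open>18/25\<close> and \<open>|B|\<close>
  near \<open>18/25 n\<close> all of these exceed \<open>268/1000 > 2 - \<surd>3\<close>.

  For the colouring, write a vertex of \<open>B\<close> as \<open>c + p q\<close> with \<open>c < p\<close>, \<open>p\<close> a large prime, and call \<open>xy\<close>
  blue when \<open>q\<^sub>x + q\<^sub>y + c\<^sub>x c\<^sub>y mod p\<close> lies in a fixed initial segment. For \<open>c\<^sub>x \<noteq> c\<^sub>x\<^sub>'\<close> the neighbourhoods of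
  \<open>x\<close> and \<open>x'\<close> are exactly independent, so the second moment method bounds the discrepancy.
\<close>

section \<open>Quasirandomness of a colouring read off from base-\<open>p\<close> digits\<close>

lemma sum_div_mod:
  fixes F :: "nat \<Rightarrow> nat \<Rightarrow> 'a::comm_monoid_add"
  shows "(\<Sum>y<m * p. F (y div p) (y mod p)) = (\<Sum>q<m. \<Sum>c<p. F q c)"
proof -
  have "(\<Sum>y<m * p. F (y div p) (y mod p)) =
      (\<Sum>q<m. \<Sum>y\<in>{q * p..<q * p + p}. F (y div p) (y mod p))"
    by (rule sum.nat_group [symmetric])
  also have "\<dots> = (\<Sum>q<m. \<Sum>c<p. F q c)"
  proof (rule sum.cong [OF refl])
    fix q
    have "(\<Sum>y\<in>{q * p..<q * p + p}. F (y div p) (y mod p)) =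
        (\<Sum>c<p. F ((q * p + c) div p) ((q * p + c) mod p))"
      using sum.shift_bounds_nat_ivl [of "\<lambda>y. F (y div p) (y mod p)" 0 "q * p" p]
      by (simp add: add.commute lessThan_atLeast0)
    also have "\<dots> = (\<Sum>c<p. F q c)"
      by (intro sum.cong) auto
    finally show "(\<Sum>y\<in>{q * p..<q * p + p}. F (y div p) (y mod p)) = (\<Sum>c<p. F q c)" .
  qed
  finally show ?thesis .
qed

text \<open>The quotient \<open>y div p\<close> runs over \<open>t\<close> full periods modulo
  \<open>p\<close>, so every pair of lowest digits \<open>(d, c)\<close> occurs exactly
  \<open>t\<close> times.\<close>

lemma sum_two_digits:
  fixes F :: "nat \<Rightarrow> nat \<Rightarrow> real"
  shows "(\<Sum>y<t * p * p. F (y div p mod p) (y mod p)) = real t * (\<Sum>d<p. \<Sum>c<p. F d c)"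
proof -
  have "(\<Sum>y<t * p * p. F (y div p mod p) (y mod p)) = (\<Sum>q<t * p. \<Sum>c<p. F (q mod p) c)"
    using sum_div_mod [of "\<lambda>q c. F (q mod p) c" p "t * p"] by simp
  also have "\<dots> = (\<Sum>k<t. \<Sum>d<p. \<Sum>c<p. F d c)"
    using sum_div_mod [of "\<lambda>k d. \<Sum>c<p. F d c" p t] by simp
  finally show ?thesis by simp
qed

text \<open>Modulo \<open>p\<close>, the product \<open>x * y\<close> only depends on the last digits of \<open>x\<close> and \<open>y\<close> in base \<open>p\<close>.\<close>

definition shade :: "nat \<Rightarrow> nat \<Rightarrow> nat \<Rightarrow> nat" where
  "shade p x y = (x div p + y div p + x * y) mod p"

lemma shade_commute: "shade p x y = shade p y x"
  by (simp add: shade_def ac_simps)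

lemma shade_digits: "shade p x y = (x div p + y div p mod p + x * (y mod p)) mod p"
  unfolding shade_def
  by (metis mod_add_cong mod_add_right_eq mod_mult_right_eq)

text \<open>Translation permutes the residues. The monoid is left general because the same fact
  later rotates a cyclic ordering, with values in \<open>nat\<close>.\<close>

lemma sum_shift_mod:
  fixes G :: "nat \<Rightarrow> 'a::comm_monoid_add"
  assumes "p > 0"
  shows "(\<Sum>d<p. G ((a + d) mod p)) = (\<Sum>r<p. G r)"
proof (rule sum.reindex_bij_betw)
  have "inj_on (\<lambda>d. (a + d) mod p) {..<p}"
  proof (rule inj_onI)
    fix d d' assume "d \<in> {..<p}" "d' \<in> {..<p}" "(a + d) mod p = (a + d') mod p"
    then show "d = d'"
      using cong_add_lcancel_nat [of a d d' p] by (simp add: cong_def)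
  qed
  moreover have "(\<lambda>d. (a + d) mod p) ` {..<p} \<subseteq> {..<p}"
    using assms by auto
  ultimately show "bij_betw (\<lambda>d. (a + d) mod p) {..<p} {..<p}"
    by (simp add: bij_betw_def endo_inj_surj)
qed

text \<open>For a fixed last digit of \<open>y\<close>, the next digit translates the shade, so all
  shades from \<open>x\<close> are equally frequent. This makes the blue degrees exact rather than
  approximate.\<close>

lemma sum_shade:
  fixes G :: "nat \<Rightarrow> real"
  assumes "p > 0"
  shows "(\<Sum>y<t * p * p. G (shade p x y)) = real t * real p * (\<Sum>r<p. G r)"
proof -
  have "(\<Sum>y<t * p * p. G (shade p x y)) =
      real t * (\<Sum>d<p. \<Sum>c<p. G ((x div p + d + x * c) mod p))"
    unfolding shade_digits by (rule sum_two_digits)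
  also have "(\<Sum>d<p. \<Sum>c<p. G ((x div p + d + x * c) mod p)) =
      (\<Sum>c<p. \<Sum>d<p. G ((x div p + x * c + d) mod p))"
    by (subst sum.swap) (simp add: ac_simps)
  also have "\<dots> = real p * (\<Sum>r<p. G r)"
    using assms by (simp add: sum_shift_mod)
  finally show ?thesis by simp
qed

text \<open>The two affine forms in \<open>(d, c)\<close> have determinant \<open>x' - x\<close>, a
  unit modulo the prime \<open>p\<close>; together they permute the pairs of residues, and the sum
  factorises.\<close>

lemma sum_affine_pair_mod:
  fixes G :: "nat \<Rightarrow> real"
  assumes p: "prime p" and ne: "\<not> [x = x'] (mod p)"
  shows "(\<Sum>d<p. \<Sum>c<p. G ((a + d + x * c) mod p) * G ((a' + d + x' * c) mod p)) = (\<Sum>r<p. G r)\<^sup>2"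
proof -
  let ?D = "{..<p} \<times> {..<p}"
  let ?h = "\<lambda>(d, c). ((a + d + x * c) mod p, (a' + d + x' * c) mod p)"
  have "p > 0" using p prime_gt_0_nat by blast
  have inj: "inj_on ?h ?D"
  proof (rule inj_onI, clarify)
    fix d c e b
    assume lt: "d < p" "c < p" "e < p" "b < p"
      and 1: "(a + d + x * c) mod p = (a + e + x * b) mod p"
      and 2: "(a' + d + x' * c) mod p = (a' + e + x' * b) mod p"
    have 1: "[int d + int x * int c = int e + int x * int b] (mod int p)"
      using 1 cong_add_lcancel_nat [of a "d + x * c" "e + x * b" p]
      by (simp add: cong_def add.assoc flip: of_nat_mult of_nat_add zmod_int)
    have 2: "[int d + int x' * int c = int e + int x' * int b] (mod int p)"
      using 2 cong_add_lcancel_nat [of a' "d + x' * c" "e + x' * b" p]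
      by (simp add: cong_def add.assoc flip: of_nat_mult of_nat_add zmod_int)
    \<comment> \<open>Subtracting eliminates the digit \<open>d\<close>. The work is done in
      \<open>int\<close> since \<open>x - x'\<close> may be negative.\<close>
    have "[(int d + int x * int c) - (int d + int x' * int c) =
        (int e + int x * int b) - (int e + int x' * int b)] (mod int p)"
      using 1 2 by (rule cong_diff)
    then have "[(int x - int x') * int c = (int x - int x') * int b] (mod int p)"
      by (simp add: algebra_simps)
    then have "int p dvd (int x - int x') * (int c - int b)"
      by (simp add: cong_iff_dvd_diff algebra_simps)
    then have "int p dvd int x - int x' \<or> int p dvd int c - int b"
      using p by (simp add: prime_dvd_mult_iff)
    moreover have "\<not> int p dvd int x - int x'"
      using ne by (simp add: cong_iff_dvd_diff flip: cong_int_iff)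
    ultimately have "[int c = int b] (mod int p)"
      by (simp add: cong_iff_dvd_diff)
    then have "c = b"
      using lt by (simp add: cong_int_iff cong_less_modulus_unique_nat)
    moreover from this 1 have "[int d = int e] (mod int p)"
      by (simp add: cong_add_rcancel)
    then have "d = e"
      using lt by (simp add: cong_int_iff cong_less_modulus_unique_nat)
    ultimately show "d = e \<and> c = b" by simp
  qed
  moreover have "?h ` ?D \<subseteq> ?D"
    using \<open>p > 0\<close> by auto
  ultimately have bij: "bij_betw ?h ?D ?D"
    by (simp add: bij_betw_def endo_inj_surj)
  have "(\<Sum>d<p. \<Sum>c<p. G ((a + d + x * c) mod p) * G ((a' + d + x' * c) mod p)) =
      (\<Sum>w\<in>?D. G (fst (?h w)) * G (snd (?h w)))"
    by (simp add: sum.cartesian_product case_prod_unfold)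
  also have "\<dots> = (\<Sum>w\<in>?D. G (fst w) * G (snd w))"
    by (rule sum.reindex_bij_betw [OF bij])
  also have "\<dots> = (\<Sum>r<p. \<Sum>r'<p. G r * G r')"
    by (simp add: sum.cartesian_product case_prod_unfold)
  finally show ?thesis
    by (simp add: power2_eq_square sum_product)
qed

text \<open>Exact independence: with \<open>M = t * p * p\<close> terms, the average of the product
  equals the product of the averages. For centred \<open>G\<close> the sum vanishes.\<close>

lemma sum_shade_pair:
  fixes G :: "nat \<Rightarrow> real"
  assumes "prime p" "\<not> [x = x'] (mod p)"
  shows "(\<Sum>y<t * p * p. G (shade p x y) * G (shade p x' y)) = real t * (\<Sum>r<p. G r)\<^sup>2"
  unfolding shade_digits
  by (subst sum_two_digits [of "\<lambda>d c. G ((x div p + d + x * c) mod p) * G ((x' div p + d + x' * c) mod p)"])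
    (simp add: sum_affine_pair_mod [OF assms])

lemma sum_cong_class:
  assumes "p > 0"
  shows "(\<Sum>y<t * p * p. of_bool ([x = y] (mod p)) :: real) = real t * real p"
proof -
  have "(\<Sum>y<t * p * p. of_bool ([x = y] (mod p))) =
      real t * (\<Sum>d<p. \<Sum>c<p. of_bool (x mod p = c))"
    using sum_two_digits [of "\<lambda>d c. of_bool (x mod p = c)" p t] by (simp add: cong_def)
  also have "(\<Sum>c<p. of_bool (x mod p = c)) = (1 :: real)"
    using assms by (simp add: of_bool_def sum.delta')
  finally show ?thesis by simp
qed

text \<open>Second moment method. Distinct residues contribute nothing to the sum of squares; only
  the fraction \<open>1 / p\<close> of congruent pairs does, which yields the saving
  \<open>sqrt p\<close>.\<close>

lemma shade_discrepancy:
  fixes G :: "nat \<Rightarrow> real"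
  assumes p: "prime p" and G0: "(\<Sum>r<p. G r) = 0" and G1: "\<And>r. \<bar>G r\<bar> \<le> 1"
    and M: "M = t * p * p" and X: "X \<subseteq> {..<M}" and Y: "Y \<subseteq> {..<M}"
  shows "\<bar>\<Sum>x\<in>X. \<Sum>y\<in>Y. G (shade p x y)\<bar> \<le> (real M)\<^sup>2 / sqrt (real p)"
proof -
  have "p > 0" using p prime_gt_0_nat by blast
  define S where "S = (\<lambda>y. \<Sum>x\<in>X. G (shade p x y))"
  have pair: "(\<Sum>y<M. G (shade p x y) * G (shade p x' y)) \<le> real M * of_bool ([x = x'] (mod p))" for x x'
  proof (cases "[x = x'] (mod p)")
    case True
    have "(\<Sum>y<M. G (shade p x y) * G (shade p x' y)) \<le> (\<Sum>y<M. 1)"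
    proof (rule sum_mono)
      fix y
      have "\<bar>G (shade p x y) * G (shade p x' y)\<bar> \<le> 1 * 1"
        unfolding abs_mult by (intro mult_mono G1) auto
      then show "G (shade p x y) * G (shade p x' y) \<le> 1" by linarith
    qed
    with True show ?thesis by simp
  next
    case False
    with sum_shade_pair [OF p, of x x' G t] G0 M show ?thesis by simp
  qed
  have "(\<Sum>y<M. (S y)\<^sup>2) = (\<Sum>y<M. \<Sum>x\<in>X. \<Sum>x'\<in>X. G (shade p x y) * G (shade p x' y))"
    by (simp add: S_def power2_eq_square sum_product)
  also have "\<dots> = (\<Sum>x\<in>X. \<Sum>x'\<in>X. \<Sum>y<M. G (shade p x y) * G (shade p x' y))"
    by (subst sum.swap, rule sum.cong [OF refl], rule sum.swap)
  also have "\<dots> \<le> (\<Sum>x\<in>X. \<Sum>x'\<in>X. real M * of_bool ([x = x'] (mod p)))"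
    by (intro sum_mono pair)
  \<comment> \<open>The terms are now nonnegative, so \<open>X\<close> may be enlarged to all of
    \<open>{..<M}\<close>, where each congruence class has exactly \<open>t * p\<close>
    elements.\<close>
  also have "\<dots> \<le> (\<Sum>x<M. \<Sum>x'<M. real M * of_bool ([x = x'] (mod p)))"
    using X by (intro order_trans [OF sum_mono2 sum_mono] sum_mono2 sum_nonneg) auto
  also have "\<dots> = (real M)\<^sup>2 * (real t * real p)"
    unfolding sum_distrib_left [symmetric]
    by (simp add: M sum_cong_class [OF \<open>p > 0\<close>] power2_eq_square del: sum_of_bool_eq)
  also have "\<dots> = (real M)^3 / real p"
    using \<open>p > 0\<close> by (simp add: M field_simps power2_eq_square power3_eq_cube)
  finally have S2: "(\<Sum>y<M. (S y)\<^sup>2) \<le> (real M)^3 / real p" .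
  \<comment> \<open>Cauchy-Schwarz over \<open>Y\<close>; afterwards \<open>Y\<close> too is
    enlarged, as squares are nonnegative.\<close>
  have "(\<Sum>y\<in>Y. S y)\<^sup>2 \<le> (\<Sum>y\<in>Y. (S y)\<^sup>2) * real (card Y)"
    by (rule sum_squared_le_sum_of_squares)
  also have "\<dots> \<le> (\<Sum>y<M. (S y)\<^sup>2) * real M"
    using Y card_mono [OF _ Y] by (intro mult_mono sum_mono2) (auto intro: sum_nonneg)
  also have "\<dots> \<le> (real M)^3 / real p * real M"
    using S2 by (rule mult_right_mono) simp
  also have "\<dots> = ((real M)\<^sup>2 / sqrt (real p))\<^sup>2"
    by (simp add: power_divide power2_eq_square power3_eq_cube)
  finally have "\<bar>\<Sum>y\<in>Y. S y\<bar> \<le> (real M)\<^sup>2 / sqrt (real p)"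
    using abs_le_square_iff [of "\<Sum>y\<in>Y. S y" "(real M)\<^sup>2 / sqrt (real p)"] by simp
  moreover have "(\<Sum>y\<in>Y. S y) = (\<Sum>x\<in>X. \<Sum>y\<in>Y. G (shade p x y))"
    unfolding S_def by (rule sum.swap)
  ultimately show ?thesis by simp
qed

text \<open>One coordinate of a degenerate triple is determined by another, leaving two free
  choices. This bounds what is lost by summing over all triples instead of those with distinct
  entries.\<close>

lemma sum_of_bool_eq_le:
  fixes S T R :: "'a set"
  assumes "finite S" "finite T" "finite R" "real (card S) \<le> m" "real (card T) \<le> m" "real (card R) \<le> m"
  shows "(\<Sum>x\<in>S. \<Sum>y\<in>T. \<Sum>z\<in>R. of_bool (x = y) :: real) \<le> m\<^sup>2"
    "(\<Sum>x\<in>S. \<Sum>y\<in>T. \<Sum>z\<in>R. of_bool (x = z) :: real) \<le> m\<^sup>2"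
    "(\<Sum>x\<in>S. \<Sum>y\<in>T. \<Sum>z\<in>R. of_bool (y = z) :: real) \<le> m\<^sup>2"
proof -
  have one: "(\<Sum>y\<in>T'. of_bool (x = y) :: real) \<le> 1" if "finite T'" for T' and x :: 'a
    using that by (simp add: of_bool_def sum.delta')
  have m: "0 \<le> m" using assms(4) by linarith
  have "(\<Sum>x\<in>S. \<Sum>y\<in>T. \<Sum>z\<in>R. of_bool (x = y) :: real) = real (card R) * (\<Sum>x\<in>S. \<Sum>y\<in>T. of_bool (x = y))"
    by (simp add: sum_distrib_left)
  also have "\<dots> \<le> real (card R) * (\<Sum>x\<in>S. 1)"
    by (intro mult_left_mono sum_mono one assms) simp
  also have "\<dots> \<le> m * m" using assms m by (simp add: mult_mono)
  finally show "(\<Sum>x\<in>S. \<Sum>y\<in>T. \<Sum>z\<in>R. of_bool (x = y) :: real) \<le> m\<^sup>2"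
    by (simp add: power2_eq_square)
  have "(\<Sum>x\<in>S. \<Sum>y\<in>T. \<Sum>z\<in>R. of_bool (x = z) :: real) \<le> (\<Sum>x\<in>S. \<Sum>y\<in>T. 1)"
    by (intro sum_mono one assms)
  also have "\<dots> \<le> m * m" using assms m by (simp add: mult_mono)
  finally show "(\<Sum>x\<in>S. \<Sum>y\<in>T. \<Sum>z\<in>R. of_bool (x = z) :: real) \<le> m\<^sup>2"
    by (simp add: power2_eq_square)
  have "(\<Sum>x\<in>S. \<Sum>y\<in>T. \<Sum>z\<in>R. of_bool (y = z) :: real) \<le> (\<Sum>x\<in>S. \<Sum>y\<in>T. 1)"
    by (intro sum_mono one assms)
  also have "\<dots> \<le> m * m" using assms m by (simp add: mult_mono)
  finally show "(\<Sum>x\<in>S. \<Sum>y\<in>T. \<Sum>z\<in>R. of_bool (y = z) :: real) \<le> m\<^sup>2"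
    by (simp add: power2_eq_square)
qed

section \<open>The graph of a two-colouring: tight cycles and codegrees\<close>

locale two_colouring =
  fixes A B :: "'a set" and blue :: "'a \<Rightarrow> 'a \<Rightarrow> bool"
  assumes finite_A: "finite A" and finite_B: "finite B" and disjoint: "A \<inter> B = {}"
    and blue_in_B: "blue x y \<Longrightarrow> x \<in> B \<and> y \<in> B"
    and blue_sym: "blue x y \<longleftrightarrow> blue y x"
begin

definition edges :: "'a set set" where
  "edges = {e. e \<subseteq> A \<union> B \<and> card e = 3 \<and>
     ((\<forall>x\<in>e. \<forall>y\<in>e. x \<noteq> y \<longrightarrow> blue x y) \<or>
      (e \<inter> A \<noteq> {} \<and> (\<forall>x\<in>e. \<forall>y\<in>e. x \<noteq> y \<longrightarrow> \<not> blue x y)))}"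

text \<open>The edge condition for ordered triples. It also makes sense for repeated entries, so it
  can be summed over full products; loops \<open>blue x x\<close> may occur and affect only
  degenerate triples.\<close>

definition compat :: "'a \<Rightarrow> 'a \<Rightarrow> 'a \<Rightarrow> bool" where
  "compat x y z \<longleftrightarrow> (blue x y \<and> blue y z \<and> blue x z) \<or>
     ((x \<in> A \<or> y \<in> A \<or> z \<in> A) \<and> \<not> blue x y \<and> \<not> blue y z \<and> \<not> blue x z)"

lemma edges_iff:
  assumes "x \<noteq> y" "x \<noteq> z" "y \<noteq> z"
  shows "{x, y, z} \<in> edges \<longleftrightarrow> {x, y, z} \<subseteq> A \<union> B \<and> compat x y z"
  unfolding edges_def compat_def using assms blue_sym by auto

lemma finite_edges: "finite edges"
  by (rule finite_subset [of _ "Pow (A \<union> B)"]) (auto simp: edges_def finite_A finite_B)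

lemma three_graph_edges: "three_graph (A \<union> B) edges"
  by (auto simp: three_graph_def edges_def finite_A finite_B)

lemma not_blue_A: "x \<in> A \<Longrightarrow> \<not> blue x y" "x \<in> A \<Longrightarrow> \<not> blue y x"
  using blue_in_B disjoint by blast+

text \<open>Consecutive edges of a tight cycle share a pair, so all its pairs have the same colour. A blue
  cycle misses \<open>A\<close>, while every edge of a red one meets \<open>A\<close> and every vertex lies in three edges.\<close>

lemma no_tight_Hamiltonian_cycle:
  assumes "A \<noteq> {}" and small: "3 * card A < card (A \<union> B)"
  shows "\<not> tight_Hamiltonian_cycle (A \<union> B) edges vs"
proof
  assume "tight_Hamiltonian_cycle (A \<union> B) edges vs"
  then have len: "length vs \<ge> 4" and dist: "distinct vs" and set: "set vs = A \<union> B"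
    and edge: "\<And>i. i < length vs \<Longrightarrow>
      {vs ! i, vs ! ((i + 1) mod length vs), vs ! ((i + 2) mod length vs)} \<in> edges"
    by (auto simp: tight_Hamiltonian_cycle_def tight_cycle_def)
  define m where "m = length vs"
  \<comment> \<open>Periodic extension of the cycle, which removes the wrap-around from the
    induction on consecutive pairs.\<close>
  define w where "w = (\<lambda>i. vs ! (i mod m))"
  have m: "m \<ge> 4" using len by (simp add: m_def)
  then have "0 < m" by simp
  then have mod_less: "i mod m < length vs" for i
    unfolding m_def [symmetric] by simp
  have ne: "w i \<noteq> w (i + k)" if "0 < k" "k < m" for i k
  proof
    assume "w i = w (i + k)"
    then have "i mod m = (i + k) mod m"
      using dist mod_less by (simp add: w_def nth_eq_iff_index_eq)
    then have "[i + 0 = i + k] (mod m)" by (simp add: cong_def)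
    then have "[0 = k] (mod m)" by (simp only: cong_add_lcancel_nat)
    then show False using that by (simp add: cong_def)
  qed
  have compat: "compat (w i) (w (i + 1)) (w (i + 2))" for i
  proof -
    from edge [OF mod_less] have "{w i, w (i + 1), w (i + 2)} \<in> edges"
      by (simp add: w_def m_def mod_simps)
    moreover have "w i \<noteq> w (i + 1)" "w i \<noteq> w (i + 2)" "w (i + 1) \<noteq> w (i + 2)"
      using ne [of 1 i] ne [of 2 i] ne [of 1 "i + 1"] m by auto
    ultimately show ?thesis by (simp add: edges_iff)
  qed
  have step: "blue (w (Suc i)) (w (Suc (Suc i))) \<longleftrightarrow> blue (w i) (w (Suc i))" for i
    using compat [of i] by (auto simp: compat_def)
  have same: "blue (w i) (w (Suc i)) \<longleftrightarrow> blue (w 0) (w 1)" for i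
    by (induction i) (simp_all add: step)
  show False
  proof (cases "blue (w 0) (w 1)")
    case True
    from \<open>A \<noteq> {}\<close> obtain a where "a \<in> A" by blast
    then obtain i where i: "i < m" "vs ! i = a"
      using set m_def by (metis UnCI in_set_conv_nth)
    then have "w i = a" by (simp add: w_def)
    with True same [of i] not_blue_A \<open>a \<in> A\<close> show False by auto
  next
    case False
    \<comment> \<open>Every rotation of the Hamiltonian cycle visits \<open>A\<close> exactly
      \<open>card A\<close> times.\<close>
    have shift: "(\<Sum>i<m. of_bool (w (k + i) \<in> A)) = card A" for k
    proof -
      have "(\<Sum>i<m. of_bool (w (k + i) \<in> A)) = (\<Sum>i<m. of_bool (vs ! i \<in> A) :: nat)"
        unfolding w_def using m by (intro sum_shift_mod) simp
      also have "\<dots> = (\<Sum>v\<in>set vs. of_bool (v \<in> A))"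
        using sum.reindex_bij_betw [OF bij_betw_nth [OF dist, of "{..<m}" "set vs"]]
        by (simp add: m_def del: sum_of_bool_eq)
      also have "\<dots> = card A"
        by (simp add: set finite_A finite_B Int_absorb1 flip: Int_def)
      finally show ?thesis .
    qed
    \<comment> \<open>A red edge meets \<open>A\<close>, so every window of three consecutive
      vertices does; summing over all windows counts each vertex of \<open>A\<close> three
      times.\<close>
    have "1 \<le> (\<Sum>k<3. of_bool (w (k + i) \<in> A) :: nat)" for i
      using compat [of i] same [of i] False
      by (auto simp: compat_def numeral_3_eq_3 add.commute)
    then have "(\<Sum>i<m. 1) \<le> (\<Sum>i<m. \<Sum>k<3. of_bool (w (k + i) \<in> A) :: nat)"
      by (intro sum_mono)
    also have "\<dots> = (\<Sum>k<3. \<Sum>i<m. of_bool (w (k + i) \<in> A))"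
      by (rule sum.swap)
    also have "\<dots> = 3 * card A"
      unfolding shift by simp
    finally have "m \<le> 3 * card A" by simp
    moreover have "m = card (A \<union> B)"
      using distinct_card [OF dist] by (simp add: set m_def)
    ultimately show False using small by simp
  qed
qed

lemma card_le_codegree:
  assumes "u \<noteq> v" "u \<notin> W" "v \<notin> W" "\<And>w. w \<in> W \<Longrightarrow> {u, v, w} \<in> edges"
  shows "card W \<le> codegree edges u v"
  unfolding codegree_def
proof (rule card_inj_on_le)
  show "inj_on (\<lambda>w. {u, v, w}) W"
    using assms(1-3) by (auto simp: inj_on_def doubleton_eq_iff insert_eq_iff)
qed (use assms(4) finite_edges in auto)

text \<open>All pairs meeting \<open>A\<close> are red, so each vertex of \<open>A\<close> other
  than \<open>u\<close> and \<open>v\<close> completes a red pair to an edge. The \<open>2\<close>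
  pays for \<open>u\<close> and \<open>v\<close>.\<close>

lemma codegree_red:
  assumes "u \<in> A \<union> B" "v \<in> A \<union> B" "u \<noteq> v" "\<not> blue u v"
  shows "card A \<le> codegree edges u v + 2"
proof -
  have "card (A - {u, v}) \<le> codegree edges u v"
    using assms not_blue_A
    by (intro card_le_codegree) (auto simp: edges_iff compat_def)
  moreover have "card A - card {u, v} \<le> card (A - {u, v})"
    by (rule diff_card_le_card_Diff) simp
  ultimately show ?thesis using assms(3) by simp
qed

text \<open>By inclusion-exclusion inside \<open>B\<close> there are at least
  \<open>2 * k - card B\<close> common blue neighbours, each closing a blue triangle; again
  \<open>u\<close> and \<open>v\<close> are discarded.\<close>

lemma codegree_blue:
  assumes "u \<noteq> v" "blue u v" and deg: "\<And>x. x \<in> B \<Longrightarrow> k \<le> card {y \<in> B. blue x y}"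
  shows "2 * k \<le> codegree edges u v + card B + 2"
proof -
  let ?N = "\<lambda>x. {y \<in> B. blue x y}"
  have uv: "u \<in> B" "v \<in> B" using assms(2) blue_in_B by auto
  have "card (?N u \<inter> ?N v - {u, v}) \<le> codegree edges u v"
    using assms(1,2) uv blue_sym
    by (intro card_le_codegree) (auto simp: edges_iff compat_def)
  moreover have "card (?N u \<inter> ?N v) - card {u, v} \<le> card (?N u \<inter> ?N v - {u, v})"
    by (rule diff_card_le_card_Diff) simp
  moreover have "card (?N u) + card (?N v) = card (?N u \<union> ?N v) + card (?N u \<inter> ?N v)"
    using finite_B by (intro card_Un_Int) auto
  moreover have "card (?N u \<union> ?N v) \<le> card B"
    using finite_B by (intro card_mono) auto
  ultimately show ?thesis
    using assms(1) deg [OF uv(1)] deg [OF uv(2)] by simp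
qed

lemma min_codegree_ge:
  assumes deg: "\<And>x. x \<in> B \<Longrightarrow> k \<le> card {y \<in> B. blue x y}"
    and "2 \<le> card (A \<union> B)" "q + 2 \<le> card A" "q + card B + 2 \<le> 2 * k"
  shows "q \<le> min_codegree (A \<union> B) edges"
  unfolding min_codegree_def
proof (rule Min.boundedI)
  let ?C = "{codegree edges u v |u v. u \<in> A \<union> B \<and> v \<in> A \<union> B \<and> u \<noteq> v}"
  have "?C \<subseteq> (\<lambda>(u, v). codegree edges u v) ` ((A \<union> B) \<times> (A \<union> B))" by auto
  then show "finite ?C"
    by (rule finite_subset) (simp add: finite_A finite_B)
  \<comment> \<open>Two distinct vertices make the set of codegrees nonempty, as \<open>Min\<close>
    requires.\<close>
  obtain u v where "u \<in> A \<union> B" "v \<in> A \<union> B" "u \<noteq> v"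
    using assms(2) card_le_Suc0_iff_eq [of "A \<union> B"] finite_A finite_B
    by (auto simp: numeral_2_eq_2 not_le Suc_le_eq)
  then show "?C \<noteq> {}" by blast
next
  fix c assume "c \<in> {codegree edges u v |u v. u \<in> A \<union> B \<and> v \<in> A \<union> B \<and> u \<noteq> v}"
  then obtain u v where c: "c = codegree edges u v"
    and uv: "u \<in> A \<union> B" "v \<in> A \<union> B" "u \<noteq> v" by blast
  show "q \<le> c"
  proof (cases "blue u v")
    case True
    from codegree_blue [OF uv(3) True deg] assms(4) c show ?thesis by simp
  next
    case False
    from codegree_red [OF uv False] assms(3) c show ?thesis by simp
  qed
qed

text \<open>Real-valued, to be summed; it precedes the next locale because the discrepancy
  assumption there is phrased with it.\<close>

definition b :: "'a \<Rightarrow> 'a \<Rightarrow> real" where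
  "b x y = of_bool (blue x y)"

end

section \<open>Density of the graph of a quasirandom colouring\<close>

locale quasirandom_colouring = two_colouring +
  fixes u \<epsilon> :: real
  assumes u_ge_0: "0 \<le> u" and u_le_1: "u \<le> 1"
    and discrepancy: "\<lbrakk>X \<subseteq> B; Y \<subseteq> B\<rbrakk> \<Longrightarrow>
      \<bar>(\<Sum>x\<in>X. \<Sum>y\<in>Y. b x y) - u * real (card X) * real (card Y)\<bar> \<le> \<epsilon>"
begin

lemma epsilon_ge_0: "0 \<le> \<epsilon>"
  using discrepancy [of "{}" "{}"] by simp

text \<open>Blue pairs lie inside \<open>B\<close>, so their number is controlled by the parts of
  \<open>X\<close> and \<open>Y\<close> in \<open>B\<close>; enlarging these back to
  \<open>X\<close> and \<open>Y\<close> only weakens the upper bound.\<close>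

lemma red_pairs:
  assumes X: "X \<subseteq> A \<union> B" and Y: "Y \<subseteq> A \<union> B"
  shows "(1 - u) * real (card X) * real (card Y) - \<epsilon> \<le> (\<Sum>x\<in>X. \<Sum>y\<in>Y. 1 - b x y)"
proof -
  have fin: "finite X" "finite Y"
    using X Y finite_A finite_B by (meson finite_UnI finite_subset)+
  have "(\<Sum>x\<in>X. \<Sum>y\<in>Y. b x y) = (\<Sum>x\<in>X. \<Sum>y\<in>Y \<inter> B. b x y)"
    using fin blue_in_B by (intro sum.cong refl sum.mono_neutral_right) (auto simp: b_def)
  also have "\<dots> = (\<Sum>x\<in>X \<inter> B. \<Sum>y\<in>Y \<inter> B. b x y)"
    using fin blue_in_B by (intro sum.mono_neutral_right) (auto simp: b_def)
  also have "\<dots> \<le> u * (real (card (X \<inter> B)) * real (card (Y \<inter> B))) + \<epsilon>"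
    using discrepancy [of "X \<inter> B" "Y \<inter> B"] by (simp add: algebra_simps)
  also have "\<dots> \<le> u * (real (card X) * real (card Y)) + \<epsilon>"
    using fin u_ge_0
    by (intro add_mono mult_mono mult_left_mono order_refl) (auto intro: card_mono)
  finally show ?thesis
    by (simp add: sum_subtractf algebra_simps)
qed

text \<open>Used to insert the three factors of a blue triangle one at a time, each costing a factor \<open>u\<close>;
  the vertex \<open>w\<close> opposite to the new pair is held fixed.\<close>

lemma weighted_discrepancy:
  assumes W: "W \<subseteq> B" and X: "X \<subseteq> B" and Y: "Y \<subseteq> B"
  shows "u * (\<Sum>w\<in>W. \<Sum>x\<in>X. \<Sum>y\<in>Y. of_bool (P w x) * of_bool (Q w y)) \<le>
    (\<Sum>w\<in>W. \<Sum>x\<in>X. \<Sum>y\<in>Y. of_bool (P w x) * of_bool (Q w y) * b x y) + \<epsilon> * real (card B)"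
proof -
  have fin: "finite X" "finite Y"
    using X Y finite_B finite_subset by blast+
  \<comment> \<open>For fixed \<open>w\<close> the weights cut out subsets of \<open>X\<close> and
    \<open>Y\<close>, to which the discrepancy bound applies.\<close>
  have filter: "(\<Sum>x\<in>X. \<Sum>y\<in>Y. of_bool (P w x) * of_bool (Q w y) * f x y) =
      (\<Sum>x\<in>{x \<in> X. P w x}. \<Sum>y\<in>{y \<in> Y. Q w y}. f x y)" for w and f :: "'a \<Rightarrow> 'a \<Rightarrow> real"
    unfolding sum.inter_filter [OF fin(1)] sum.inter_filter [OF fin(2)]
    by (intro sum.cong refl) (auto intro!: sum.cong)
  have "u * (\<Sum>w\<in>W. \<Sum>x\<in>X. \<Sum>y\<in>Y. of_bool (P w x) * of_bool (Q w y)) =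
      (\<Sum>w\<in>W. u * (\<Sum>x\<in>X. \<Sum>y\<in>Y. of_bool (P w x) * of_bool (Q w y) * 1))"
    by (simp only: sum_distrib_left mult_1_right)
  also have "\<dots> \<le> (\<Sum>w\<in>W. (\<Sum>x\<in>X. \<Sum>y\<in>Y. of_bool (P w x) * of_bool (Q w y) * b x y) + \<epsilon>)"
    unfolding filter
  proof (rule sum_mono)
    fix w
    show "u * (\<Sum>x\<in>{x \<in> X. P w x}. \<Sum>y\<in>{y \<in> Y. Q w y}. 1) \<le>
        (\<Sum>x\<in>{x \<in> X. P w x}. \<Sum>y\<in>{y \<in> Y. Q w y}. b x y) + \<epsilon>"
      using discrepancy [of "{x \<in> X. P w x}" "{y \<in> Y. Q w y}"] X Y
      by (simp add: subset_iff algebra_simps)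
  qed
  also have "\<dots> = (\<Sum>w\<in>W. \<Sum>x\<in>X. \<Sum>y\<in>Y. of_bool (P w x) * of_bool (Q w y) * b x y) + card W * \<epsilon>"
    by (simp only: sum.distrib sum_constant)
  also have "card W * \<epsilon> \<le> \<epsilon> * real (card B)"
    using card_mono [OF finite_B W] epsilon_ge_0 by (simp add: mult.commute mult_left_mono)
  finally show ?thesis by simp
qed

text \<open>The pairs \<open>xz\<close>, \<open>xy\<close>, \<open>yz\<close> are inserted in this
  order, with \<open>y\<close>, \<open>z\<close>, \<open>x\<close> held fixed. The errors \<delta>,
  \<open>u * \<delta>\<close> and \<open>u * u * \<delta>\<close> are each at most \<delta>, since
  \<open>u\<close> is at most \<open>1\<close>.\<close>

lemma blue_triangles:
  assumes X: "X \<subseteq> B" and Y: "Y \<subseteq> B" and Z: "Z \<subseteq> B"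
  shows "u ^ 3 * (real (card X) * real (card Y) * real (card Z)) - 3 * \<epsilon> * real (card B) \<le>
    (\<Sum>x\<in>X. \<Sum>y\<in>Y. \<Sum>z\<in>Z. b x y * b x z * b y z)"
proof -
  define T0 where "T0 = real (card X) * real (card Y) * real (card Z)"
  define T1 where "T1 = (\<Sum>x\<in>X. \<Sum>y\<in>Y. \<Sum>z\<in>Z. b x z)"
  define T2 where "T2 = (\<Sum>x\<in>X. \<Sum>y\<in>Y. \<Sum>z\<in>Z. b x y * b x z)"
  define T3 where "T3 = (\<Sum>x\<in>X. \<Sum>y\<in>Y. \<Sum>z\<in>Z. b x y * b x z * b y z)"
  have YXZ: "(\<Sum>y\<in>Y. \<Sum>x\<in>X. \<Sum>z\<in>Z. f x y z) = (\<Sum>x\<in>X. \<Sum>y\<in>Y. \<Sum>z\<in>Z. f x y z)"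
    for f :: "'a \<Rightarrow> 'a \<Rightarrow> 'a \<Rightarrow> real" by (rule sum.swap)
  have ZXY: "(\<Sum>z\<in>Z. \<Sum>x\<in>X. \<Sum>y\<in>Y. f x y z) = (\<Sum>x\<in>X. \<Sum>y\<in>Y. \<Sum>z\<in>Z. f x y z)"
    for f :: "'a \<Rightarrow> 'a \<Rightarrow> 'a \<Rightarrow> real"
    by (subst sum.swap) (rule sum.cong [OF refl], rule sum.swap)
  define \<delta> where "\<delta> = \<epsilon> * real (card B)"
  have "0 \<le> \<delta>" using epsilon_ge_0 by (simp add: \<delta>_def)
  have 1: "u * T0 \<le> T1 + \<delta>"
    using weighted_discrepancy [OF Y X Z, of "\<lambda>_ _. True" "\<lambda>_ _. True"]
    unfolding YXZ by (simp add: T0_def T1_def \<delta>_def ac_simps)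
  have 2: "u * T1 \<le> T2 + \<delta>"
    using weighted_discrepancy [OF Z X Y, of "\<lambda>z x. blue x z" "\<lambda>_ _. True"]
    unfolding ZXY by (simp add: T1_def T2_def \<delta>_def b_def ac_simps)
  have 3: "u * T2 \<le> T3 + \<delta>"
    using weighted_discrepancy [OF X Y Z, of blue blue]
    by (simp only: T2_def T3_def \<delta>_def b_def)
  have "u * \<delta> \<le> \<delta>" "u * (u * \<delta>) \<le> u * \<delta>"
    using \<open>0 \<le> \<delta>\<close> u_ge_0 u_le_1 by (auto intro: mult_left_mono mult_left_le_one_le)
  moreover have "u * (u * (u * T0)) \<le> u * (u * (T1 + \<delta>))" "u * (u * T1) \<le> u * (T2 + \<delta>)"
    using 1 2 u_ge_0 by (auto intro: mult_left_mono)
  ultimately have "u * (u * (u * T0)) - 3 * \<delta> \<le> T3"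
    using 3 by (simp add: algebra_simps)
  then show ?thesis
    by (simp add: T0_def T3_def \<delta>_def power3_eq_cube ac_simps)
qed

text \<open>On triples with distinct entries \<open>compat\<close> is the edge relation; each of the
  three possible coincidences costs at most the square of the number of vertices.\<close>

lemma edge_count_ge:
  assumes X: "X \<subseteq> A \<union> B" and Y: "Y \<subseteq> A \<union> B" and Z: "Z \<subseteq> A \<union> B"
  shows "(\<Sum>x\<in>X. \<Sum>y\<in>Y. \<Sum>z\<in>Z. of_bool (compat x y z)) - 3 * (real (card (A \<union> B)))\<^sup>2
    \<le> real (edge_count edges X Y Z)"
proof -
  have fin: "finite X" "finite Y" "finite Z"
    using X Y Z finite_A finite_B by (meson finite_UnI finite_subset)+
  have card: "card X \<le> card (A \<union> B)" "card Y \<le> card (A \<union> B)" "card Z \<le> card (A \<union> B)"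
    using X Y Z finite_A finite_B by (auto intro: card_mono)
  let ?P = "\<lambda>x y z. x \<noteq> y \<and> x \<noteq> z \<and> y \<noteq> z \<and> {x, y, z} \<in> edges"
  have "edge_count edges X Y Z = card {w \<in> X \<times> Y \<times> Z. case w of (x, y, z) \<Rightarrow> ?P x y z}"
    unfolding edge_count_def by (rule arg_cong [of _ _ card]) auto
  also have "real \<dots> = (\<Sum>w\<in>X \<times> Y \<times> Z. of_bool (case w of (x, y, z) \<Rightarrow> ?P x y z))"
    using fin by (simp add: Int_def conj_commute)
  also have "\<dots> = (\<Sum>x\<in>X. \<Sum>y\<in>Y. \<Sum>z\<in>Z. of_bool (?P x y z))"
    unfolding sum.cartesian_product by (rule sum.cong) (auto split: prod.splits)
  finally have "real (edge_count edges X Y Z) = (\<Sum>x\<in>X. \<Sum>y\<in>Y. \<Sum>z\<in>Z. of_bool (?P x y z))" .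
  moreover have "(\<Sum>x\<in>X. \<Sum>y\<in>Y. \<Sum>z\<in>Z. of_bool (compat x y z)) \<le>
      (\<Sum>x\<in>X. \<Sum>y\<in>Y. \<Sum>z\<in>Z. of_bool (?P x y z) +
        (of_bool (x = y) + (of_bool (x = z) + of_bool (y = z))) :: real)"
    using X Y Z by (intro sum_mono) (auto simp: edges_iff)
  ultimately show ?thesis
    using sum_of_bool_eq_le [OF fin, of "real (card (A \<union> B))"] card
    unfolding sum.distrib by linarith
qed

text \<open>Triples meeting \<open>A\<close> have density at least \<open>1 - u\<close>, those
  inside \<open>B\<close> at least \<open>u ^ 3\<close>, up to errors. Three classes meeting
  \<open>A\<close> cost one error term each and the blue triangles three, hence the
  \<open>6\<close>.\<close>

lemma sum_compat_ge:
  assumes X: "X \<subseteq> A \<union> B" and Y: "Y \<subseteq> A \<union> B" and Z: "Z \<subseteq> A \<union> B"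
    and d: "0 \<le> d" "d \<le> 1 - u" "d \<le> u ^ 3"
  shows "d * real (card X) * real (card Y) * real (card Z) - 6 * \<epsilon> * real (card (A \<union> B)) \<le>
    (\<Sum>x\<in>X. \<Sum>y\<in>Y. \<Sum>z\<in>Z. of_bool (compat x y z))"
proof -
  define n where "n = real (card (A \<union> B))"
  define f where "f = (\<lambda>X Y Z. \<Sum>x\<in>X. \<Sum>y\<in>Y. \<Sum>z\<in>Z. of_bool (compat x y z) :: real)"
  have fin: "finite S" if "S \<subseteq> A \<union> B" for S
    using that finite_A finite_B by (meson finite_UnI finite_subset)
  have card_le: "real (card S) \<le> n" if "S \<subseteq> A \<union> B" for S
    using that finite_A finite_B unfolding n_def by (simp add: card_mono)
  have split: "S = (S \<inter> A) \<union> (S \<inter> B)" if "S \<subseteq> A \<union> B" for S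
    using that by blast
  have sum_split: "(\<Sum>x\<in>S. g x) = (\<Sum>x\<in>S \<inter> A. g x) + (\<Sum>x\<in>S \<inter> B. g x)"
    if "S \<subseteq> A \<union> B" for S and g :: "'a \<Rightarrow> real"
    using that fin [OF that] disjoint
    by (subst (1) split [OF that]) (rule sum.union_disjoint, auto)
  have card_split: "real (card S) = real (card (S \<inter> A)) + real (card (S \<inter> B))"
    if "S \<subseteq> A \<union> B" for S
    using sum_split [OF that, of "\<lambda>_. 1"] by simp
  \<comment> \<open>Split by the first of the three vertices that lies in \<open>A\<close>; the other two then form the only
    pair that can be blue.\<close>
  have "f X Y Z = f (X \<inter> A) Y Z + f (X \<inter> B) Y Z"
    unfolding f_def by (rule sum_split [OF X])
  also have "f (X \<inter> B) Y Z = f (X \<inter> B) (Y \<inter> A) Z + f (X \<inter> B) (Y \<inter> B) Z"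
    unfolding f_def sum_split [OF Y] sum.distrib ..
  also have "f (X \<inter> B) (Y \<inter> B) Z = f (X \<inter> B) (Y \<inter> B) (Z \<inter> A) + f (X \<inter> B) (Y \<inter> B) (Z \<inter> B)"
    unfolding f_def sum_split [OF Z] sum.distrib ..
  finally have f: "f X Y Z = f (X \<inter> A) Y Z + (f (X \<inter> B) (Y \<inter> A) Z +
    (f (X \<inter> B) (Y \<inter> B) (Z \<inter> A) + f (X \<inter> B) (Y \<inter> B) (Z \<inter> B)))" .
  have sub: "S \<inter> A \<subseteq> A \<union> B" "S \<inter> B \<subseteq> A \<union> B" for S by auto
  have red: "d * (real (card S) * real (card R) * real (card T)) - \<epsilon> * n \<le>
      real (card S) * (\<Sum>x\<in>R. \<Sum>y\<in>T. 1 - b x y)"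
    if "S \<subseteq> A \<union> B" "R \<subseteq> A \<union> B" "T \<subseteq> A \<union> B" for S R T
  proof -
    have "d * (real (card R) * real (card T)) \<le> (1 - u) * (real (card R) * real (card T))"
      using d(2) by (intro mult_right_mono) auto
    then have "d * (real (card R) * real (card T)) - \<epsilon> \<le> (\<Sum>x\<in>R. \<Sum>y\<in>T. 1 - b x y)"
      using red_pairs [OF that(2,3)] by (simp add: mult.assoc)
    then have "real (card S) * (d * (real (card R) * real (card T)) - \<epsilon>) \<le>
        real (card S) * (\<Sum>x\<in>R. \<Sum>y\<in>T. 1 - b x y)"
      by (rule mult_left_mono) simp
    moreover have "real (card S) * \<epsilon> \<le> \<epsilon> * n"
      using card_le [OF that(1)] epsilon_ge_0 by (simp add: mult.commute mult_left_mono)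
    ultimately show ?thesis by (simp add: algebra_simps)
  qed
  have "f (X \<inter> A) Y Z = (\<Sum>x\<in>X \<inter> A. \<Sum>y\<in>Y. \<Sum>z\<in>Z. 1 - b y z)"
    unfolding f_def by (intro sum.cong refl) (auto simp: compat_def b_def not_blue_A)
  then have 1: "d * (real (card (X \<inter> A)) * real (card Y) * real (card Z)) - \<epsilon> * n \<le> f (X \<inter> A) Y Z"
    using red [OF sub(1) Y Z, of X] by simp
  have "f (X \<inter> B) (Y \<inter> A) Z = (\<Sum>x\<in>X \<inter> B. \<Sum>y\<in>Y \<inter> A. \<Sum>z\<in>Z. 1 - b x z)"
    unfolding f_def by (intro sum.cong refl) (auto simp: compat_def b_def not_blue_A)
  also have "\<dots> = (\<Sum>y\<in>Y \<inter> A. \<Sum>x\<in>X \<inter> B. \<Sum>z\<in>Z. 1 - b x z)"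
    by (rule sum.swap)
  finally have 2: "d * (real (card (Y \<inter> A)) * real (card (X \<inter> B)) * real (card Z)) - \<epsilon> * n
      \<le> f (X \<inter> B) (Y \<inter> A) Z"
    using red [OF sub(1) sub(2) Z, of Y X] by simp
  have "f (X \<inter> B) (Y \<inter> B) (Z \<inter> A) = (\<Sum>x\<in>X \<inter> B. \<Sum>y\<in>Y \<inter> B. \<Sum>z\<in>Z \<inter> A. 1 - b x y)"
    unfolding f_def by (intro sum.cong refl) (auto simp: compat_def b_def not_blue_A)
  then have 3: "d * (real (card (Z \<inter> A)) * real (card (X \<inter> B)) * real (card (Y \<inter> B))) - \<epsilon> * n
      \<le> f (X \<inter> B) (Y \<inter> B) (Z \<inter> A)"
    using red [OF sub(1) sub(2) sub(2), of Z X Y] by (simp add: sum_distrib_left)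
  have "(\<Sum>x\<in>X \<inter> B. \<Sum>y\<in>Y \<inter> B. \<Sum>z\<in>Z \<inter> B. b x y * b x z * b y z) \<le> f (X \<inter> B) (Y \<inter> B) (Z \<inter> B)"
    unfolding f_def by (intro sum_mono) (auto simp: compat_def b_def)
  moreover have "d * (real (card (X \<inter> B)) * real (card (Y \<inter> B)) * real (card (Z \<inter> B))) \<le>
      u ^ 3 * (real (card (X \<inter> B)) * real (card (Y \<inter> B)) * real (card (Z \<inter> B)))"
    using d(3) by (intro mult_right_mono) auto
  moreover have "\<epsilon> * real (card B) \<le> \<epsilon> * n"
    using card_le [of B] epsilon_ge_0 by (simp add: mult_left_mono)
  ultimately have 4: "d * (real (card (X \<inter> B)) * real (card (Y \<inter> B)) * real (card (Z \<inter> B))) -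
      3 * (\<epsilon> * n) \<le> f (X \<inter> B) (Y \<inter> B) (Z \<inter> B)"
    using blue_triangles [of "X \<inter> B" "Y \<inter> B" "Z \<inter> B"] by simp
  have "d * real (card X) * real (card Y) * real (card Z) =
      d * (real (card (X \<inter> A)) * real (card Y) * real (card Z)) +
      d * (real (card (Y \<inter> A)) * real (card (X \<inter> B)) * real (card Z)) +
      d * (real (card (Z \<inter> A)) * real (card (X \<inter> B)) * real (card (Y \<inter> B))) +
      d * (real (card (X \<inter> B)) * real (card (Y \<inter> B)) * real (card (Z \<inter> B)))"
    unfolding card_split [OF X] card_split [OF Y] card_split [OF Z] by (simp add: algebra_simps)
  with 1 2 3 4 f have "d * real (card X) * real (card Y) * real (card Z) - 6 * (\<epsilon> * n) \<le> f X Y Z"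
    by linarith
  then show ?thesis by (simp add: f_def n_def)
qed

lemma dense_edges:
  assumes "0 \<le> d" "d \<le> 1 - u" "d \<le> u ^ 3"
    and "6 * \<epsilon> * real (card (A \<union> B)) + 3 * (real (card (A \<union> B)))\<^sup>2 \<le> \<rho> * real (card (A \<union> B)) ^ 3"
  shows "dense_three_graph \<rho> d (A \<union> B) edges"
  unfolding dense_three_graph_def
proof (intro allI impI)
  fix X Y Z assume XYZ: "X \<subseteq> A \<union> B" "Y \<subseteq> A \<union> B" "Z \<subseteq> A \<union> B"
  show "d * real (card X) * real (card Y) * real (card Z) - \<rho> * real (card (A \<union> B)) ^ 3
      \<le> real (edge_count edges X Y Z)"
    using edge_count_ge [OF XYZ] sum_compat_ge [OF XYZ assms(1-3)] assms(4) by linarith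
qed

end

section \<open>Choice of parameters and conclusion\<close>

lemma ex_multiple_in_window:
  assumes "q > 0" "50 * q \<le> n"
  obtains t where "7 / 10 * real n \<le> real (t * q)" "real (t * q) \<le> 18 / 25 * real n"
proof
  \<comment> \<open>The largest multiple of \<open>q\<close> up to \<open>18 / 25 * n\<close> falls
    short by less than \<open>q\<close>, and \<open>q\<close> is at most \<open>n / 50\<close>, the
    width of the window.\<close>
  let ?t = "18 * n div (25 * q)"
  have "18 * n < (?t + 1) * (25 * q)"
    using assms(1) by (intro div_less_iff_less_mult [THEN iffD1]) auto
  then have "18 * n < 25 * (?t * q) + 25 * q"
    by (simp add: algebra_simps)
  then have "18 * real n < 25 * real (?t * q) + 25 * real q"
    by linarith
  with assms(2) show "7 / 10 * real n \<le> real (?t * q)" by linarith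
  have "?t * (25 * q) \<le> 18 * n" by (rule div_times_less_eq_dividend)
  then have "25 * (?t * q) \<le> 18 * n" by (simp add: ac_simps)
  then show "real (?t * q) \<le> 18 / 25 * real n" by linarith
qed

lemma d_star_bounds: "0 \<le> d_star" "d_star \<le> 268 / 1000"
proof -
  have "sqrt 3 \<le> 2" by (rule real_le_lsqrt) auto
  then show "0 \<le> d_star" by (simp add: d_star_def)
  have "1732 / 1000 \<le> sqrt 3" by (rule real_le_rsqrt) (simp add: power2_eq_square)
  then show "d_star \<le> 268 / 1000" by (simp add: d_star_def)
qed

text \<open>A pair is blue when its shade is below \<open>s\<close>. The indicator of this segment
  minus \<open>s / p\<close> has sum zero, so the discrepancy bound applies to it; equidistribution
  of shades gives every vertex of \<open>B\<close> the same degree \<open>s / p * M\<close>.\<close>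

lemma ex_quasirandom_colouring:
  assumes p: "prime p" and s: "s \<le> p" and M: "M = t * p * p" and n: "M \<le> n"
  obtains blue where
    "quasirandom_colouring {M..<n} {..<M} blue (real s / real p) ((real M)\<^sup>2 / sqrt (real p))"
    "\<And>x. x < M \<Longrightarrow> card {y \<in> {..<M}. blue x y} = t * p * s"
proof -
  have p0: "p > 0" using p prime_gt_0_nat by blast
  define blue where "blue = (\<lambda>x y. x < M \<and> y < M \<and> shade p x y < s)"
  interpret two_colouring "{M..<n}" "{..<M}" blue
    by unfold_locales (auto simp: blue_def shade_commute)
  have sum_s: "(\<Sum>r<p. of_bool (r < s)) = real s"
  proof -
    have "{..<p} \<inter> {r. r < s} = {..<s}" using s by auto
    then show ?thesis by simp
  qed
  have "quasirandom_colouring {M..<n} {..<M} blue (real s / real p) ((real M)\<^sup>2 / sqrt (real p))"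
  proof (unfold_locales)
    show "0 \<le> real s / real p" "real s / real p \<le> 1"
      using s p0 by simp_all
    fix X Y assume XY: "X \<subseteq> {..<M}" "Y \<subseteq> {..<M}"
    define G where "G = (\<lambda>r. of_bool (r < s) - real s / real p)"
    have "(\<Sum>r<p. G r) = 0"
      using p0 by (simp add: G_def sum_subtractf sum_s del: sum_of_bool_eq)
    moreover have "\<bar>G r\<bar> \<le> 1" for r
      using s p0 by (auto simp: G_def abs_le_iff field_simps)
    ultimately have "\<bar>\<Sum>x\<in>X. \<Sum>y\<in>Y. G (shade p x y)\<bar> \<le> (real M)\<^sup>2 / sqrt (real p)"
      using shade_discrepancy p M XY by blast
    also have "(\<Sum>x\<in>X. \<Sum>y\<in>Y. G (shade p x y)) = (\<Sum>x\<in>X. \<Sum>y\<in>Y. b x y - real s / real p)"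
    proof (intro sum.cong refl)
      fix x y assume "x \<in> X" "y \<in> Y"
      with XY have "blue x y \<longleftrightarrow> shade p x y < s" by (auto simp: blue_def)
      then show "G (shade p x y) = b x y - real s / real p" by (simp add: G_def b_def)
    qed
    also have "\<dots> = (\<Sum>x\<in>X. \<Sum>y\<in>Y. b x y) - real s / real p * real (card X) * real (card Y)"
      by (simp add: sum_subtractf ac_simps)
    finally show "\<bar>(\<Sum>x\<in>X. \<Sum>y\<in>Y. b x y) - real s / real p * real (card X) * real (card Y)\<bar>
        \<le> (real M)\<^sup>2 / sqrt (real p)" .
  qed
  moreover have "card {y \<in> {..<M}. blue x y} = t * p * s" if "x < M" for x
  proof -
    have "(\<Sum>y<M. of_bool (shade p x y < s)) = real t * real p * real s"
      using sum_shade [OF p0, of "\<lambda>r. of_bool (r < s)" x t] sum_s M by simp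
    moreover have "{..<M} \<inter> {y. shade p x y < s} = {y \<in> {..<M}. blue x y}"
      using that by (auto simp: blue_def)
    ultimately have "real (card {y \<in> {..<M}. blue x y}) = real (t * p * s)"
      by simp
    then show ?thesis by (simp only: of_nat_eq_iff)
  qed
  ultimately show thesis using that by blast
qed

theorem theorem1p4:
  fixes \<gamma> \<rho> :: real
  assumes "\<gamma> > 0" and "\<rho> > 0"
  shows "\<exists>n0 :: nat. \<forall>n \<ge> n0. \<exists>(V :: nat set) (E :: nat set set).
           three_graph V E \<and> card V = n \<and>
           dense_three_graph \<rho> d_star V E \<and>
           real (min_codegree V E) \<ge> (d_star - \<gamma>) * real n \<and>
           \<not> (\<exists>vs. tight_Hamiltonian_cycle V E vs)"
proof -
  \<comment> \<open>The bound \<open>100\<close> controls the rounding in \<open>s\<close>; the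
    other makes the discrepancy at most \<open>\<rho> / 12 * n ^ 2\<close>, so that six error terms
    use half of the allowance \<rho>.\<close>
  obtain p where p: "prime p" and p_gt: "p > max 100 (nat \<lceil>(12 / \<rho>)\<^sup>2\<rceil>)"
    using bigger_prime by blast
  have p100: "real p \<ge> 100" and "real p \<ge> (12 / \<rho>)\<^sup>2" using p_gt by linarith+
  then have sqrt_p: "12 / \<rho> \<le> sqrt (real p)" by (intro real_le_rsqrt)
  define s where "s = 18 * p div 25"
  have "real (25 * s) \<le> real (18 * p)" "real (18 * p) \<le> real (25 * s + 25)"
    unfolding s_def of_nat_le_iff by linarith+
  then have s: "25 * real s \<le> 18 * real p" "18 * real p \<le> 25 * real s + 25"
    by simp_all
  define u where "u = real s / real p"
  \<comment> \<open>Rounding loses at most \<open>1 / p\<close>. The upper bound gives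
    \<open>1 - u\<close> at least \<open>28 / 100\<close>, the lower one \<open>u ^ 3\<close> above
    \<open>35 / 100\<close> and \<open>2 * u - 1\<close> at least \<open>42 / 100\<close>.\<close>
  have u: "71 / 100 \<le> u" "u \<le> 18 / 25"
    using s p100 by (auto simp: u_def field_simps)
  have "s \<le> p" using s p100 by linarith
  show ?thesis
  \<comment> \<open>\<open>50 * (p * p)\<close> leaves room for a multiple of \<open>p * p\<close>
    in the window; \<open>6 / \<rho>\<close> lets the degenerate triples fit into the other half of
    \<rho>.\<close>
  proof (intro exI [of _ "max (50 * (p * p)) (nat \<lceil>6 / \<rho>\<rceil>)"] allI impI)
    fix n assume n: "max (50 * (p * p)) (nat \<lceil>6 / \<rho>\<rceil>) \<le> n"
    have "100 * 100 \<le> p * p" using p100 by (intro mult_mono) auto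
    with n have n500: "n \<ge> 500" and n\<rho>: "real n \<ge> 6 / \<rho>" by linarith+
    obtain t where t: "7 / 10 * real n \<le> real (t * (p * p))" "real (t * (p * p)) \<le> 18 / 25 * real n"
    proof (rule ex_multiple_in_window)
      show "p * p > 0" "50 * (p * p) \<le> n"
        using n p by (simp_all add: prime_gt_0_nat)
    qed
    define M where "M = t * p * p"
    have M: "7 / 10 * real n \<le> real M" "real M \<le> 18 / 25 * real n"
      using t by (simp_all add: M_def mult.assoc)
    then have "M \<le> n" by linarith
    let ?A = "{M..<n}" and ?B = "{..<M}"
    obtain blue where qc: "quasirandom_colouring ?A ?B blue u ((real M)\<^sup>2 / sqrt (real p))"
      and deg: "\<And>x. x < M \<Longrightarrow> card {y \<in> ?B. blue x y} = t * p * s"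
      using ex_quasirandom_colouring [OF p \<open>s \<le> p\<close> M_def \<open>M \<le> n\<close>] u_def by blast
    interpret quasirandom_colouring ?A ?B blue u "(real M)\<^sup>2 / sqrt (real p)" by (rule qc)
    have V: "?A \<union> ?B = {..<n}" using \<open>M \<le> n\<close> by auto
    have card_A: "real (card ?A) = real n - real M" using \<open>M \<le> n\<close> by simp
    have "dense_three_graph \<rho> d_star (?A \<union> ?B) edges"
    proof (rule dense_edges)
      show "0 \<le> d_star" "d_star \<le> 1 - u" using d_star_bounds u by linarith+
      have "(71 / 100) ^ 3 \<le> u ^ 3" using u by (intro power_mono) auto
      then show "d_star \<le> u ^ 3" using d_star_bounds by (simp add: power3_eq_cube)
      have "(real M)\<^sup>2 / sqrt (real p) \<le> (real n)\<^sup>2 / (12 / \<rho>)"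
        using sqrt_p \<open>M \<le> n\<close> assms(2) by (intro frac_le power_mono) auto
      then have "6 * ((real M)\<^sup>2 / sqrt (real p)) * real n \<le> 6 * ((real n)\<^sup>2 / (12 / \<rho>)) * real n"
        by (intro mult_right_mono mult_left_mono) auto
      also have "\<dots> = \<rho> / 2 * real n ^ 3"
        by (simp add: power2_eq_square power3_eq_cube)
      finally have 1: "6 * ((real M)\<^sup>2 / sqrt (real p)) * real n \<le> \<rho> / 2 * real n ^ 3" .
      have "3 \<le> \<rho> / 2 * real n" using n\<rho> assms(2) by (simp add: field_simps)
      then have "3 * (real n)\<^sup>2 \<le> \<rho> / 2 * real n * (real n)\<^sup>2"
        by (rule mult_right_mono) simp
      then have "3 * (real n)\<^sup>2 \<le> \<rho> / 2 * real n ^ 3"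
        by (simp add: power2_eq_square power3_eq_cube ac_simps)
      with 1 show "6 * ((real M)\<^sup>2 / sqrt (real p)) * real (card (?A \<union> ?B)) +
          3 * (real (card (?A \<union> ?B)))\<^sup>2 \<le> \<rho> * real (card (?A \<union> ?B)) ^ 3"
        by (simp add: V)
    qed
    moreover have "(d_star - \<gamma>) * real n \<le> real (min_codegree (?A \<union> ?B) edges)"
    proof -
      \<comment> \<open>Red pairs offer at least \<open>28 / 100 * n\<close> and blue ones at least
        \<open>42 / 100 * 7 / 10 * n = 294 / 1000 * n\<close>; for \<open>n\<close> at least
        \<open>500\<close> the surplus over \<open>268 / 1000 * n\<close> absorbs the rounding and
        the two discarded vertices.\<close>
      define q where "q = nat \<lceil>268 / 1000 * real n\<rceil>"
      have q: "268 / 1000 * real n \<le> real q" "real q \<le> 268 / 1000 * real n + 1"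
        unfolding q_def by linarith+
      have "real (t * p * s) = u * real M"
        using p100 by (simp add: u_def M_def)
      moreover have "71 / 100 * real M \<le> u * real M"
        using u by (intro mult_right_mono) auto
      ultimately have "71 / 100 * real M \<le> real (t * p * s)" by simp
      then have "real (q + M + 2) \<le> real (2 * (t * p * s))"
        using q M n500 unfolding of_nat_add of_nat_mult [of 2] by simp
      then have "q + card ?B + 2 \<le> 2 * (t * p * s)"
        by (simp only: of_nat_le_iff card_lessThan)
      moreover have "q + 2 \<le> card ?A"
      proof -
        have "real (q + 2) \<le> real (card ?A)"
          using q M n500 unfolding card_A by simp
        then show ?thesis by (simp only: of_nat_le_iff)
      qed
      ultimately have "q \<le> min_codegree (?A \<union> ?B) edges"
        using deg n500 by (intro min_codegree_ge) (auto simp: V)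
      moreover have "(d_star - \<gamma>) * real n \<le> 268 / 1000 * real n"
        using d_star_bounds assms(1) by (intro mult_right_mono) auto
      ultimately show ?thesis using q by linarith
    qed
    moreover have "\<not> tight_Hamiltonian_cycle (?A \<union> ?B) edges vs" for vs
    proof (rule no_tight_Hamiltonian_cycle)
      \<comment> \<open>The window for \<open>M\<close> puts \<open>card ?A\<close> between
        \<open>7 / 25 * n\<close> and \<open>3 / 10 * n\<close>, the latter being below a
        third.\<close>
      show "3 * card ?A < card (?A \<union> ?B)" "?A \<noteq> {}"
        using M n500 card_A unfolding V by auto
    qed
    moreover have "card (?A \<union> ?B) = n" by (simp add: V)
    ultimately show "\<exists>(V :: nat set) (E :: nat set set).
           three_graph V E \<and> card V = n \<and>
           dense_three_graph \<rho> d_star V E \<and>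
           real (min_codegree V E) \<ge> (d_star - \<gamma>) * real n \<and>
           \<not> (\<exists>vs. tight_Hamiltonian_cycle V E vs)"
      using three_graph_edges by blast
  qed
qed

end
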